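(* Let $\mathcal{A}$ be an associative $\mathbb{C}$-algebra (not necessarily commutative), let $n\geq 1$, let $\lambda$ be a self-conjugate partition of $n$, and let $A\in\operatorname{Mat}_{N,N}(\mathcal{A})$. Then for any $g\in GL_N(\mathbb{C})$, $$\operatorname{imm}^{*\lambda}_n (gAg^{-1})=\operatorname{imm}^{*\lambda}_n A.$$
   Context: $\operatorname{Mat}_{N,N}(\mathcal{A})$ is the set of $N\times N$ matrices with entries in $\mathcal{A}$, $[N]=\{1,\ldots,N\}$, and $i$ is the imaginary unit. Complex matrices multiply matrices over $\mathcal{A}$ via the scalar action of $\mathbb{C}$ on $\mathcal{A}$. For $X=(x_{ij})\in\operatorname{Mat}_{N,N}(\mathcal{A})$ and $I=(i_1,\ldots,i_n)\in[N]^n$, put $X_{II}=(x_{i_s i_t})_{1\leq s,t\leq n}$ (repetitions allowed). Definition of $\chi^{*\lambda}$. Let $\lambda$ be a self-conjugate partition of $n$ ($\lambda=\lambda'$), and let $r$ be its rank (the length of its main diagonal). Put $m(\lambda)=\frac12(n-r)$ (an integer) and $\mu=h(\lambda)=(\mu_1,\ldots,\mu_r)=(2\lambda_1-1,2\lambda_2-3,\ldots,2\lambda_r-(2r-1))$, the sequence of lengths of the diagonal hooks of $\lambda$; it is a partition of $n$ into distinct odd parts. For $\sigma\in\mathfrak{S}_n$ of cycle type $\mu$, write $\sigma=(i_{11}\ i_{12}\ \ldots\ i_{1\mu_1})(i_{21}\ \ldots\ i_{2\mu_2})\cdots(i_{r1}\ \ldots\ i_{r\mu_r})$ with cycles ordered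 by decreasing length, and let $f(\sigma)=1$ (resp. $-1$) if the number of inversions of the sequence $(i_{11},\ldots,i_{1\mu_1},i_{21},\ldots,i_{2\mu_2},\ldots,i_{r1},\ldots,i_{r\mu_r})$ is even (resp. odd); this is well defined since the $\mu_k$ are odd and distinct. Define $\chi^{*\lambda}:\mathfrak{S}_n\to\mathbb{C}$ by $$\chi^{*\lambda}(\sigma)=\begin{cases} f(\sigma)\, i^{m(\lambda)}\sqrt{\mu_1\cdots\mu_r}, & \text{if } \sigma \text{ has cycle type } \mu=h(\lambda),\\ 0,&\text{otherwise.}\end{cases}$$ For an $n\times n$ matrix $X=(x_{ij})$ over $\mathcal{A}$, the (row) twisted immanant is $\operatorname{imm}^{*\lambda}X=\sum_{\sigma\in\mathfrak{S}_n}\chi^{*\lambda}(\sigma)\,x_{1\sigma(1)}\cdots x_{n\sigma(n)}$ (product in this order). For $A\in\operatorname{Mat}_{N,N}(\mathcal{A})$, put $\operatorname{imm}^{*\lambda}_n A=\frac{1}{n!}\sum_{I\in[N]^n}\operatorname{imm}^{*\lambda}A_{II}$. *)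

theory Defs
  imports "HOL-Analysis.Analysis" "HOL-Combinatorics.Combinatorics"
begin

(* Associative complex algebras, neither commutative nor unital in general:
   the class ring provides an associative, possibly non-unital multiplication. *)
locale complex_algebra = vector_space smul
  for smul :: "complex \<Rightarrow> 'a::ring \<Rightarrow> 'a" +
  assumes mult_scale_left: "smul c x * y = smul c (x * y)"
    and mult_scale_right: "x * smul c y = smul c (x * y)"

(* Partitions are weakly decreasing lists of positive parts, so the part with
   one-based index k + 1 is lam ! k. *)
definition is_partition :: "nat \<Rightarrow> nat list \<Rightarrow> bool" where
  "is_partition n lam \<longleftrightarrow>
     sorted_wrt (\<ge>) lam \<and> (\<forall>p\<in>set lam. 0 < p) \<and> sum_list lam = n"

definition conj_partition :: "nat list \<Rightarrow> nat list" where
  "conj_partition lam =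
     (case lam of [] \<Rightarrow> [] | p # _ \<Rightarrow> map (\<lambda>j. length (filter (\<lambda>x. j < x) lam)) [0..<p])"

definition self_conjugate :: "nat list \<Rightarrow> bool" where
  "self_conjugate lam \<longleftrightarrow> conj_partition lam = lam"

definition durfee_rank :: "nat list \<Rightarrow> nat" where
  "durfee_rank lam = card {k. k < length lam \<and> k < lam ! k}"

(* Below the rank k < lam ! k, so the truncated subtraction is exact. *)
definition diag_hooks :: "nat list \<Rightarrow> nat list" where
  "diag_hooks lam = map (\<lambda>k. 2 * lam ! k - (2 * k + 1)) [0..<durfee_rank lam]"

(* css lists the cycles of sigma, fixed points included, in an order in which
   their lengths are mu; a cycle (a b c ...) sends a to b, b to c, and so on. *)
definition cycle_writing :: "nat \<Rightarrow> nat list \<Rightarrow> (nat \<Rightarrow> nat) \<Rightarrow> nat list list \<Rightarrow> bool" where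
  "cycle_writing n mu \<sigma> css \<longleftrightarrow>
     map length css = mu \<and> distinct (concat css) \<and> set (concat css) = {1..n} \<and>
     \<sigma> = foldr (\<lambda>c \<tau>. cycle_of_list c \<circ> \<tau>) css id"

definition has_cycle_type :: "nat \<Rightarrow> nat list \<Rightarrow> (nat \<Rightarrow> nat) \<Rightarrow> bool" where
  "has_cycle_type n mu \<sigma> \<longleftrightarrow> \<sigma> permutes {1..n} \<and> (\<exists>css. cycle_writing n mu \<sigma> css)"

definition inversions :: "nat list \<Rightarrow> (nat \<times> nat) set" where
  "inversions xs = {(a, b). a < b \<and> b < length xs \<and> xs ! b < xs ! a}"

(* When the parts of mu are distinct and odd, a permutation of cycle type mu
   determines its writing up to rotating each cycle, which is an even
   rearrangement: the value does not depend on the writing chosen. *)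
definition cycle_sign :: "nat \<Rightarrow> nat list \<Rightarrow> (nat \<Rightarrow> nat) \<Rightarrow> complex" where
  "cycle_sign n mu \<sigma> =
     (if even (card (inversions (concat (SOME css. cycle_writing n mu \<sigma> css)))) then 1 else -1)"

(* For self-conjugate lam, n - durfee_rank lam is even, so the division is exact. *)
definition twisted_char :: "nat \<Rightarrow> nat list \<Rightarrow> (nat \<Rightarrow> nat) \<Rightarrow> complex" where
  "twisted_char n lam \<sigma> =
     (if has_cycle_type n (diag_hooks lam) \<sigma>
      then cycle_sign n (diag_hooks lam) \<sigma> * \<i> ^ ((n - durfee_rank lam) div 2) *
           complex_of_real (sqrt (real (prod_list (diag_hooks lam))))
      else 0)"

(* Product in list order.  The library's prod_list needs a unit; here the empty
   product is left unspecified. *)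
fun ordered_prod :: "'a::semigroup_mult list \<Rightarrow> 'a" where
  "ordered_prod [x] = x"
| "ordered_prod (x # y # xs) = x * ordered_prod (y # xs)"

(* Row twisted immanant of an n x n matrix, indexed by {1..n}. *)
definition twisted_imm ::
  "(complex \<Rightarrow> 'a::ring \<Rightarrow> 'a) \<Rightarrow> nat \<Rightarrow> nat list \<Rightarrow> (nat \<Rightarrow> nat \<Rightarrow> 'a) \<Rightarrow> 'a" where
  "twisted_imm smul n lam X =
     (\<Sum>\<sigma> | \<sigma> permutes {1..n}.
        smul (twisted_char n lam \<sigma>) (ordered_prod (map (\<lambda>s. X s (\<sigma> s)) [1..<Suc n])))"

definition twisted_imm_sum ::
  "(complex \<Rightarrow> 'a::ring \<Rightarrow> 'a) \<Rightarrow> nat \<Rightarrow> nat list \<Rightarrow> 'a^'N^'N \<Rightarrow> 'a" where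
  "twisted_imm_sum smul n lam A =
     smul (1 / fact n)
       (\<Sum>I \<in> {1..n} \<rightarrow>\<^sub>E (UNIV :: 'N set). twisted_imm smul n lam (\<lambda>s t. A $ I s $ I t))"

definition scalar_matrix_mult_left ::
  "(complex \<Rightarrow> 'a::ring \<Rightarrow> 'a) \<Rightarrow> complex^'N^'N \<Rightarrow> 'a^'N^'N \<Rightarrow> 'a^'N^'N" where
  "scalar_matrix_mult_left smul g A = (\<chi> i j. \<Sum>k\<in>UNIV. smul (g $ i $ k) (A $ k $ j))"

definition scalar_matrix_mult_right ::
  "(complex \<Rightarrow> 'a::ring \<Rightarrow> 'a) \<Rightarrow> 'a^'N^'N \<Rightarrow> complex^'N^'N \<Rightarrow> 'a^'N^'N" where
  "scalar_matrix_mult_right smul A h = (\<chi> i j. \<Sum>k\<in>UNIV. smul (h $ k $ j) (A $ i $ k))"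

end

theory Submission
  imports Defs
begin

text \<open>
  Every permutation contributes an invariant summand on its own, whatever its coefficient.
  For fixed \<open>\<sigma>\<close>, the sum over \<open>I\<close> of
  the products of the entries \<open>A\<^bsub>I s, I (\<sigma> s)\<^esub>\<close> behaves like a
  trace: complex factors can be pulled out of the ordered product, and renaming the summation
  indices along \<open>\<sigma>\<close> shows that it takes equal values at \<open>gM\<close> and
  \<open>Mg\<close>. Apply this to \<open>M = Ag\<^sup>-\<^sup>1\<close>.
\<close>

context complex_algebra
begin

text \<open>Distributivity for noncommuting factors: a term of the expansion chooses one index
  \<open>f s\<close> per position. Scalars move past every algebra element, so they gather in front
  while the order of the \<open>x s (f s)\<close> is kept. An empty list is excluded because
  \<open>ordered_prod []\<close> is unspecified.\<close>

lemma ordered_prod_sum_PiE: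
  assumes "xs \<noteq> []" "distinct xs" "finite P"
  shows "ordered_prod (map (\<lambda>s. \<Sum>p\<in>P. smul (c s p) (x s p)) xs)
       = (\<Sum>f\<in>set xs \<rightarrow>\<^sub>E P. smul (\<Prod>s\<in>set xs. c s (f s))
           (ordered_prod (map (\<lambda>s. x s (f s)) xs)))"
  using assms(1,2)
proof (induction xs rule: list_nonempty_induct)
  case (single a)
  have "(\<Sum>f\<in>{a} \<rightarrow>\<^sub>E P. smul (c a (f a)) (x a (f a))) = (\<Sum>p\<in>P. smul (c a p) (x a p))"
    by (rule sum.reindex_bij_witness[where j = "\<lambda>f. f a" and i = "\<lambda>p. \<lambda>s\<in>{a}. p"])
      (auto simp: PiE_def extensional_def)
  then show ?case by simp
next
  case (cons a xs)
  \<comment> \<open>The recursive equation of \<open>ordered_prod\<close> fires only on a visible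
    second element; the induction guarantees one, as \<open>xs\<close> is nonempty.\<close>
  have [simp]: "ordered_prod (y # map f xs) = y * ordered_prod (map f xs)" for y and f :: "_ \<Rightarrow> 'a"
    using cons.hyps by (cases xs) auto
  have a: "a \<notin> set xs" using cons.prems by simp
  \<comment> \<open>A choice function on \<open>set (a # xs)\<close> is a value \<open>p\<close> at
    \<open>a\<close> together with a choice function on \<open>set xs\<close>.\<close>
  have inj: "inj_on (\<lambda>(p, f). f(a := p)) (P \<times> (set xs \<rightarrow>\<^sub>E P))"
    by (rule inj_combinator[OF a])
  have upd: "map (\<lambda>s. x s (if s = a then p else f s)) xs = map (\<lambda>s. x s (f s)) xs"
    "(\<Prod>s\<in>set xs. c s (if s = a then p else f s)) = (\<Prod>s\<in>set xs. c s (f s))" for p f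
    using a by (auto intro!: prod.cong)
  have "(\<Sum>f\<in>set (a # xs) \<rightarrow>\<^sub>E P. smul (\<Prod>s\<in>set (a # xs). c s (f s))
           (ordered_prod (map (\<lambda>s. x s (f s)) (a # xs))))
      = (\<Sum>(p, f)\<in>P \<times> (set xs \<rightarrow>\<^sub>E P). smul (c a p * (\<Prod>s\<in>set xs. c s (f s)))
           (x a p * ordered_prod (map (\<lambda>s. x s (f s)) xs)))"
    using a by (simp add: PiE_insert_eq sum.reindex[OF inj] upd)
      (simp add: case_prod_unfold upd)
  also have "\<dots> = (\<Sum>p\<in>P. smul (c a p) (x a p)) *
      (\<Sum>f\<in>set xs \<rightarrow>\<^sub>E P. smul (\<Prod>s\<in>set xs. c s (f s))
           (ordered_prod (map (\<lambda>s. x s (f s)) xs)))"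
    by (simp add: sum_product sum.cartesian_product mult_scale_left mult_scale_right
        mult.commute)
  finally show ?case using cons by simp
qed

text \<open>The analogue of the trace identity tr(gA) = tr(Ag), one \<sigma> at a time: the sum over
  column indices on one side serves as the sum over intermediate indices on the other.\<close>

lemma sum_ordered_prod_mult_commute:
  fixes A :: "'a^'N^'N" and g :: "complex^'N^'N"
  assumes "n \<ge> 1" and \<sigma>: "\<sigma> permutes {1..n}"
  shows "(\<Sum>I\<in>{1..n} \<rightarrow>\<^sub>E UNIV. ordered_prod
            (map (\<lambda>s. scalar_matrix_mult_left smul g A $ I s $ I (\<sigma> s)) [1..<Suc n]))
       = (\<Sum>I\<in>{1..n} \<rightarrow>\<^sub>E UNIV. ordered_prod
            (map (\<lambda>s. scalar_matrix_mult_right smul A g $ I s $ I (\<sigma> s)) [1..<Suc n]))"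
proof -
  let ?E = "{1..n} \<rightarrow>\<^sub>E (UNIV :: 'N set)"
  let ?xs = "[1..<Suc n]"
  have xs: "?xs \<noteq> []" "distinct ?xs" "set ?xs = {1..n}"
    using assms(1) by (auto simp del: upt_Suc One_nat_def)
  note expand = ordered_prod_sum_PiE[OF xs(1,2) finite_class.finite_UNIV, unfolded xs(3)]
  have mem: "\<sigma> s \<in> {1..n}" "inv \<sigma> s \<in> {1..n}" if "s \<in> {1..n}" for s
    using permutes_in_image[OF \<sigma>] permutes_in_image[OF permutes_inv[OF \<sigma>]] that by auto
  have "(\<Sum>I\<in>?E. ordered_prod
            (map (\<lambda>s. scalar_matrix_mult_left smul g A $ I s $ I (\<sigma> s)) ?xs))
      = (\<Sum>I\<in>?E. \<Sum>K\<in>?E. smul (\<Prod>s=1..n. g $ I s $ K s)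
            (ordered_prod (map (\<lambda>s. A $ K s $ I (\<sigma> s)) ?xs)))"
    by (simp add: scalar_matrix_mult_left_def expand del: upt_Suc One_nat_def)
  also have "\<dots> = (\<Sum>K\<in>?E. \<Sum>I\<in>?E. smul (\<Prod>s=1..n. g $ I s $ K s)
            (ordered_prod (map (\<lambda>s. A $ K s $ I (\<sigma> s)) ?xs)))"
    by (rule sum.swap)
  \<comment> \<open>Substitute J = I o \<sigma>. Now \<open>K\<close> plays the role of the outer
    index and \<open>J\<close> that of the intermediate index in the expansion of the right
    multiple.\<close>
  also have "\<dots> = (\<Sum>K\<in>?E. \<Sum>J\<in>?E. smul (\<Prod>s=1..n. g $ J s $ K (\<sigma> s))
            (ordered_prod (map (\<lambda>s. A $ K s $ J s) ?xs)))"
  proof (rule sum.cong[OF refl])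
    fix K
    show "(\<Sum>I\<in>?E. smul (\<Prod>s=1..n. g $ I s $ K s)
            (ordered_prod (map (\<lambda>s. A $ K s $ I (\<sigma> s)) ?xs)))
        = (\<Sum>J\<in>?E. smul (\<Prod>s=1..n. g $ J s $ K (\<sigma> s))
            (ordered_prod (map (\<lambda>s. A $ K s $ J s) ?xs)))"
    \<comment> \<open>Restricting to \<open>{1..n}\<close> keeps the composites extensional, as
      membership in \<open>?E\<close> demands.\<close>
    proof (rule sum.reindex_bij_witness[where
          j = "\<lambda>I. \<lambda>s\<in>{1..n}. I (\<sigma> s)" and i = "\<lambda>J. \<lambda>s\<in>{1..n}. J (inv \<sigma> s)"])
      fix I assume I: "I \<in> ?E"
      show "(\<lambda>s\<in>{1..n}. (\<lambda>s\<in>{1..n}. I (\<sigma> s)) (inv \<sigma> s)) = I"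
        using I mem by (auto simp: fun_eq_iff permutes_inverses[OF \<sigma>] PiE_def extensional_def)
      show "(\<lambda>s\<in>{1..n}. (\<lambda>s\<in>{1..n}. I (inv \<sigma> s)) (\<sigma> s)) = I"
        using I mem by (auto simp: fun_eq_iff permutes_inverses[OF \<sigma>] PiE_def extensional_def)
      have "(\<Prod>s=1..n. g $ (\<lambda>s\<in>{1..n}. I (\<sigma> s)) s $ K (\<sigma> s))
          = (\<Prod>s=1..n. g $ I s $ K s)"
        \<comment> \<open>Only the commuting complex factors are permuted; the algebra factors stay
          in place.\<close>
        using prod.permute[OF \<sigma>, of "\<lambda>s. g $ I s $ K s"] by (simp add: o_def)
      moreover have "map (\<lambda>s. A $ K s $ (\<lambda>s\<in>{1..n}. I (\<sigma> s)) s) ?xs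
          = map (\<lambda>s. A $ K s $ I (\<sigma> s)) ?xs"
        using xs(3) by (intro map_cong) (auto simp del: upt_Suc One_nat_def)
      ultimately show "smul (\<Prod>s=1..n. g $ (\<lambda>s\<in>{1..n}. I (\<sigma> s)) s $ K (\<sigma> s))
            (ordered_prod (map (\<lambda>s. A $ K s $ (\<lambda>s\<in>{1..n}. I (\<sigma> s)) s) ?xs))
          = smul (\<Prod>s=1..n. g $ I s $ K s)
            (ordered_prod (map (\<lambda>s. A $ K s $ I (\<sigma> s)) ?xs))"
        by (simp only:)
    qed auto
  qed
  also have "\<dots> = (\<Sum>I\<in>?E. ordered_prod
            (map (\<lambda>s. scalar_matrix_mult_right smul A g $ I s $ I (\<sigma> s)) ?xs))"
    by (simp add: scalar_matrix_mult_right_def expand del: upt_Suc One_nat_def)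
  finally show ?thesis .
qed

lemma twisted_imm_sum_mult_commute:
  assumes "n \<ge> 1"
  shows "twisted_imm_sum smul n lam (scalar_matrix_mult_left smul g A)
       = twisted_imm_sum smul n lam (scalar_matrix_mult_right smul A g)"
  unfolding twisted_imm_sum_def twisted_imm_def
  \<comment> \<open>With \<sigma> summed outermost on both sides, its character value is constant in
    \<open>I\<close> and factors out.\<close>
  by (subst (1 2) sum.swap)
    (simp add: scale_sum_right[symmetric] sum_ordered_prod_mult_commute[OF assms] del: upt_Suc One_nat_def)

lemma scalar_matrix_mult_left_right:
  "scalar_matrix_mult_right smul (scalar_matrix_mult_left smul g A) h
 = scalar_matrix_mult_left smul g (scalar_matrix_mult_right smul A h)"
  unfolding scalar_matrix_mult_right_def scalar_matrix_mult_left_def vec_eq_iff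
  by (simp add: scale_sum_right, subst sum.swap) (simp add: mult.commute)

lemma scalar_matrix_mult_right_assoc:
  "scalar_matrix_mult_right smul (scalar_matrix_mult_right smul A g) h
 = scalar_matrix_mult_right smul A (g ** h)"
  unfolding scalar_matrix_mult_right_def matrix_matrix_mult_def vec_eq_iff
  by (simp add: scale_sum_right scale_sum_left, subst sum.swap) (simp add: mult.commute)

lemma scalar_matrix_mult_right_one: "scalar_matrix_mult_right smul A (mat 1) = A"
  by (simp add: scalar_matrix_mult_right_def mat_def vec_eq_iff if_distrib[of "\<lambda>c. smul c _"]
      cong: if_cong)

end

theorem theorem4p1:
  fixes smul :: "complex \<Rightarrow> 'a::ring \<Rightarrow> 'a"
    and n :: nat and lam :: "nat list"
    and A :: "'a^'N^'N" and g :: "complex^'N^'N"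
  assumes "complex_algebra smul"
    and "n \<ge> 1"
    and "is_partition n lam"
    and "self_conjugate lam"
    and "invertible g"
  shows "twisted_imm_sum smul n lam
           (scalar_matrix_mult_right smul (scalar_matrix_mult_left smul g A) (matrix_inv g))
         = twisted_imm_sum smul n lam A"
proof -
  interpret complex_algebra smul by fact
  have inv: "matrix_inv g ** g = mat 1"
    using someI_ex[OF \<open>invertible g\<close>[unfolded invertible_def]]
    unfolding matrix_inv_def by blast
  show ?thesis
    \<comment> \<open>With h the inverse of g, the rewriting runs (gA)h = g(Ah), then to (Ah)g under
      the immanant sum, then A(hg) = A.\<close>
    by (simp add: scalar_matrix_mult_left_right twisted_imm_sum_mult_commute[OF \<open>n \<ge> 1\<close>]
        scalar_matrix_mult_right_assoc inv
        scalar_matrix_mult_right_one)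
qed

end
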